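(* Let $d\ge1$ and $\alpha_i\in(0,1/i]$ for every $i\in[d+1]$, and consider the Gaussian broadcast model on $P=\mathbb Z_{\ge0}^{d+1}$. Let $C:=\max_{i\in[d+1]}i^{-1/2}\alpha_i^{-1}$. For every integer $t>\exp^{(5d+4)}(1)$ and all reals $a_u$ ($u\in L_t$), not all zero, the random variable $\zeta=\sum_{u\in L_t}a_uX_u$ satisfies $$\frac{|\operatorname{Cov}(\zeta,X_0)|}{\sqrt{\operatorname{Var}(\zeta)}}\le\frac{C}{\log^{(2d+2)}(t)}.$$
   Context: Gaussian broadcast model on the finite model: $P=\mathbb{Z}_{\ge0}^{d+1}$ with $u\le v$ iff $v-u\in\mathbb{Z}_{\ge0}^{d+1}$; $L_t$ = tuples with coordinate sum $t$; $\mathfrak p(v)$ = set of elements covered by $v$, so $|\mathfrak p(v)|$ is the number of positive coordinates; $\mathbf 0$ is the minimal element. Let $X_0\sim\mathcal N(0,1)$, independently i.i.d. $W_{u\to v}\sim\mathcal N(0,1)$ for covering pairs $u\lessdot v$, $X_{\mathbf 0}=X_0$, and $X_v=\alpha_{|\mathfrak p(v)|}\sum_{u\in\mathfrak p(v)}(X_u+W_{u\to v})$ for $v\ne\mathbf 0$. Notation: $\log^{(k)}$ and $\exp^{(k)}$ denote $k$-fold iterates of $\log$ and $\exp$. *)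

theory Defs
  imports "HOL-Probability.Probability"
begin

text \<open>Points of P = Z_{>=0}^{d+1}: functions nat => nat supported on coordinates 0..d.\<close>
definition gb_pts :: "nat \<Rightarrow> (nat \<Rightarrow> nat) set" where
  "gb_pts d = {v. \<forall>i>d. v i = 0}"

definition gb_level :: "nat \<Rightarrow> nat \<Rightarrow> (nat \<Rightarrow> nat) set" where
  "gb_level d t = {v \<in> gb_pts d. (\<Sum>i\<le>d. v i) = t}"

definition gb_parents :: "nat \<Rightarrow> (nat \<Rightarrow> nat) \<Rightarrow> (nat \<Rightarrow> nat) set" where
  "gb_parents d v = (\<lambda>i. v(i := v i - 1)) ` {i. i \<le> d \<and> 0 < v i}"

definition gb_edges :: "nat \<Rightarrow> ((nat \<Rightarrow> nat) \<times> (nat \<Rightarrow> nat)) set" where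
  "gb_edges d = {(u, v). v \<in> gb_pts d \<and> u \<in> gb_parents d v}"

text \<open>Value of X_v at level t, given the root value x0 and edge noises w.\<close>
primrec gb_X_lvl :: "nat \<Rightarrow> (nat \<Rightarrow> real) \<Rightarrow> nat \<Rightarrow> real
    \<Rightarrow> ((nat \<Rightarrow> nat) \<times> (nat \<Rightarrow> nat) \<Rightarrow> real) \<Rightarrow> (nat \<Rightarrow> nat) \<Rightarrow> real" where
  "gb_X_lvl 0 \<alpha> d x0 w v = x0"
| "gb_X_lvl (Suc t) \<alpha> d x0 w v =
     \<alpha> (card (gb_parents d v)) * (\<Sum>u\<in>gb_parents d v. gb_X_lvl t \<alpha> d x0 w u + w (u, v))"

definition gb_X :: "(nat \<Rightarrow> real) \<Rightarrow> nat \<Rightarrow> real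
    \<Rightarrow> ((nat \<Rightarrow> nat) \<times> (nat \<Rightarrow> nat) \<Rightarrow> real) \<Rightarrow> (nat \<Rightarrow> nat) \<Rightarrow> real" where
  "gb_X \<alpha> d x0 w v = gb_X_lvl (\<Sum>i\<le>d. v i) \<alpha> d x0 w v"

definition (in prob_space) covariance :: "('a \<Rightarrow> real) \<Rightarrow> ('a \<Rightarrow> real) \<Rightarrow> real" where
  "covariance X Y = expectation (\<lambda>x. (X x - expectation X) * (Y x - expectation Y))"

end

theory Submission
  imports Defs
begin

text \<open>
  Pushing the coefficients \<open>a\<close> down level by level gives weights \<open>A v\<close> on all levels \<open>\<le> t\<close> with
  \<open>Cov = A 0\<close> and \<open>Var = (A 0)^2 + \<Sum>_{v \<noteq> 0} |p(v)| \<alpha>^2 (A v)^2\<close>.  By duality, any test function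
  \<open>\<phi>\<close> with \<open>\<phi> 0 = 1\<close> and \<open>\<phi> = 0\<close> on level \<open>t\<close> satisfies
  \<open>A 0 = - \<Sum>_{v \<noteq> 0} A v (\<phi> v - \<alpha> \<Sum>_{u \<in> p(v)} \<phi> u)\<close>, so by Cauchy-Schwarz it is enough to find
  \<open>\<phi>\<close> whose defect \<open>\<phi> - \<alpha> \<Sum> \<phi>\<close> has small square sum.

  Build \<open>\<phi>\<close> on the faces of the orthant by increasing dimension: extend it harmonically (zero
  defect) into the points with \<open>k\<close> positive coordinates, and then cut it off linearly over a range of
  levels beyond the support of \<open>\<phi>\<close> on the \<open>(k-1)\<close>-dimensional faces.  Since \<open>\<alpha>_k \<le> 1/k\<close>, the mass of
  the harmonic extension per level does not grow inside a face, so it is bounded by what enters from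
  the lower faces, uniformly in the level.  A cutoff over a range much longer than this mass therefore
  costs little, and the radii only grow polynomially.
\<close>

section \<open>Covariances of linear combinations of independent standard normals\<close>

lemma (in prob_space) standard_normal_moments:
  assumes D: "distributed M lborel X std_normal_density"
  shows "integrable M X" "integrable M (\<lambda>\<omega>. X \<omega> * X \<omega>)"
    "expectation X = 0" "expectation (\<lambda>\<omega>. X \<omega> * X \<omega>) = 1"
proof -
  show X: "integrable M X"
    using distributed_integrable[OF D, of "\<lambda>x. x"] integrable_std_normal_moment[of 1]
    by simp
  show "integrable M (\<lambda>\<omega>. X \<omega> * X \<omega>)"
    using distributed_integrable[OF D, of "\<lambda>x. x * x"] integrable_std_normal_moment[of 2]
    by (simp add: power2_eq_square)
  show E: "expectation X = 0"
    by (rule standard_normal_distributed_expectation[OF D])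
  show "expectation (\<lambda>\<omega>. X \<omega> * X \<omega>) = 1"
    using standard_normal_distributed_variance[OF D] E by (simp add: power2_eq_square)
qed

lemma (in prob_space) iid_standard_normal_orthonormal:
  assumes indep: "indep_vars (\<lambda>_. borel) Z K"
    and D: "\<And>k. k \<in> K \<Longrightarrow> distributed M lborel (Z k) std_normal_density"
    and ij: "i \<in> K" "j \<in> K"
  shows "integrable M (\<lambda>\<omega>. Z i \<omega> * Z j \<omega>)"
    "expectation (\<lambda>\<omega>. Z i \<omega> * Z j \<omega>) = (if i = j then 1 else 0)"
proof -
  have "integrable M (\<lambda>\<omega>. Z i \<omega> * Z j \<omega>) \<and>
      expectation (\<lambda>\<omega>. Z i \<omega> * Z j \<omega>) = (if i = j then 1 else 0)"
  proof (cases "i = j")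
    case True
    then show ?thesis
      using standard_normal_moments[OF D[OF ij(1)]] by simp
  next
    case False
    \<comment> \<open>Pairwise independence is extracted from the family by treating
      \<open>Z j\<close> as a sum over a singleton.\<close>
    have "indep_var borel (Z i) borel (\<lambda>\<omega>. \<Sum>i\<in>{j}. Z i \<omega>)"
      using False ij by (intro indep_vars_sum indep_vars_subset[OF indep]) auto
    then have "indep_var borel (Z i) borel (Z j)"
      by simp
    with False show ?thesis
      using standard_normal_moments[OF D[OF ij(1)]] standard_normal_moments[OF D[OF ij(2)]]
      by (simp add: indep_var_lebesgue_integral indep_var_integrable)
  qed
  then show "integrable M (\<lambda>\<omega>. Z i \<omega> * Z j \<omega>)"
    "expectation (\<lambda>\<omega>. Z i \<omega> * Z j \<omega>) = (if i = j then 1 else 0)"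
    by blast+
qed

text \<open>By orthonormality, covariance becomes the Euclidean inner product of coefficient
  vectors. It will serve both for the variance of \<open>\<zeta>\<close> and for its covariance with
  the root value.\<close>

lemma (in prob_space) covariance_standard_normal_combination:
  assumes indep: "indep_vars (\<lambda>_. borel) Z K"
    and D: "\<And>k. k \<in> K \<Longrightarrow> distributed M lborel (Z k) std_normal_density"
    and J: "finite J" "J \<subseteq> K"
  shows "covariance (\<lambda>\<omega>. \<Sum>j\<in>J. b j * Z j \<omega>) (\<lambda>\<omega>. \<Sum>j\<in>J. c j * Z j \<omega>) = (\<Sum>j\<in>J. b j * c j)"
proof -
  note on = iid_standard_normal_orthonormal[OF indep D]
  have JK: "j \<in> K" if "j \<in> J" for j
    using that J by auto
  have E: "expectation (\<lambda>\<omega>. \<Sum>j\<in>J. b j * Z j \<omega>) = 0" for b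
    using standard_normal_moments[OF D[OF JK]] by (subst Bochner_Integration.integral_sum) auto
  have "covariance (\<lambda>\<omega>. \<Sum>j\<in>J. b j * Z j \<omega>) (\<lambda>\<omega>. \<Sum>j\<in>J. c j * Z j \<omega>)
      = expectation (\<lambda>\<omega>. \<Sum>i\<in>J. \<Sum>j\<in>J. (b i * c j) * (Z i \<omega> * Z j \<omega>))"
    unfolding covariance_def E by (simp add: sum_product mult_ac)
  also have "\<dots> = (\<Sum>i\<in>J. \<Sum>j\<in>J. (b i * c j) * expectation (\<lambda>\<omega>. Z i \<omega> * Z j \<omega>))"
    using on JK
    by (subst Bochner_Integration.integral_sum)
      (auto intro!: sum.cong Bochner_Integration.integral_sum)
  also have "\<dots> = (\<Sum>i\<in>J. \<Sum>j\<in>J. if i = j then b i * c j else 0)"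
    using on JK by (intro sum.cong) auto
  finally show ?thesis
    using J by simp
qed

section \<open>Iterated exponentials and logarithms\<close>

lemma le_exp_funpow: "x \<le> (exp ^^ n) (x::real)"
proof (induction n)
  case (Suc n)
  have "(exp ^^ n) x \<le> exp ((exp ^^ n) x)"
    using exp_ge_add_one_self[of "(exp ^^ n) x"] by linarith
  with Suc show ?case by simp
qed simp

lemma power2_le_exp_funpow: "2 ^ n \<le> (exp ^^ n) (1::real)"
proof (induction n)
  case (Suc n)
  define x where "x = (exp ^^ n) (1::real)"
  have x: "0 \<le> x" using Suc order_trans[of 0 "2 ^ n" x] by (simp add: x_def)
  \<comment> \<open>The aim is 2x \<le> exp x: the square gives 2x \<le> (1 + x/2)^2, and 1 + x/2
    \<le> exp (x/2).\<close>
  have "0 \<le> (1 - x / 2)\<^sup>2" by simp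
  then have "2 * x \<le> (1 + x / 2)\<^sup>2" by (simp add: power2_eq_square field_simps)
  also have "\<dots> \<le> (exp (x / 2))\<^sup>2"
    using x exp_ge_add_one_self[of "x / 2"] by (intro power_mono) auto
  also have "\<dots> = exp x" by (simp add: power2_eq_square flip: exp_add)
  finally show ?case using Suc by (simp add: x_def)
qed simp

text \<open>The number \<open>m\<close> of surviving exponentials is general because the induction
  moves one exponential from \<open>n\<close> to \<open>m\<close>. The bound keeps every
  intermediate logarithm positive, where \<open>exp (ln x) = x\<close> is available.\<close>

lemma ln_funpow_gt:
  fixes t :: real
  assumes "(exp ^^ (m + n)) 1 < t"
  shows "(exp ^^ m) 1 < (ln ^^ n) t"
  using assms
proof (induction n arbitrary: m)
  case (Suc n)
  then have *: "exp ((exp ^^ m) 1) < (ln ^^ n) t"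
    using Suc.IH[of "Suc m"] by simp
  moreover have "0 < (ln ^^ n) t"
    using * exp_gt_zero less_trans by blast
  ultimately show ?case by simp (metis exp_less_cancel_iff exp_ln)
qed simp

lemma exp_funpow_ln_funpow:
  fixes t :: real
  assumes "(exp ^^ n) 1 < t"
  shows "(exp ^^ n) ((ln ^^ n) t) = t"
  using assms
proof (induction n)
  case (Suc n)
  have "exp ((exp ^^ 0) 1) < (ln ^^ n) t"
    using ln_funpow_gt[of 1 n t] Suc.prems by simp
  then have pos: "0 < (ln ^^ n) t"
    using exp_gt_zero less_trans by blast
  have "(exp ^^ n) 1 < t"
    using Suc.prems exp_ge_add_one_self[of "(exp ^^ n) (1::real)"] unfolding funpow.simps o_apply by linarith
  with Suc.IH pos show ?case by (simp add: funpow_swap1[of exp])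
qed simp

text \<open>After one logarithm the claim is 2^(d+4) ln l \<le> exp l, and each factor on the left
  is at most exp (l/2).\<close>

lemma power_two_power_le_exp_exp:
  fixes l :: real
  assumes l: "2 * real d + 8 \<le> l"
  shows "l ^ (2 ^ (d + 4)) \<le> exp (exp l)"
proof -
  have "(2::real) ^ (d + 4) \<le> exp 1 ^ (d + 4)"
    using exp_ge_add_one_self[of 1] by (intro power_mono) auto
  also have "\<dots> = exp (real (d + 4))" by (simp only: exp_of_nat_mult[symmetric] mult_1_right)
  also have "\<dots> \<le> exp (l / 2)" using l by simp
  finally have 1: "(2::real) ^ (d + 4) \<le> exp (l / 2)" .
  have "ln l = ln 2 + ln (l / 2)" using l by (simp add: ln_div)
  also have "\<dots> \<le> 1 + (l / 2 - 1)"
    using l ln_le_minus_one[of 2] by (intro add_mono ln_le_minus_one) auto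
  also have "\<dots> \<le> exp (l / 2)" using exp_ge_add_one_self[of "l / 2"] by linarith
  finally have 2: "ln l \<le> exp (l / 2)" .
  have "2 ^ (d + 4) * ln l \<le> exp (l / 2) * exp (l / 2)"
    using 1 2 l by (intro mult_mono) auto
  also have "\<dots> = exp l" by (simp flip: exp_add)
  finally have *: "2 ^ (d + 4) * ln l \<le> exp l" .
  have "l ^ (2 ^ (d + 4)) = exp (2 ^ (d + 4) * ln l)"
    using l exp_of_nat_mult[of "2 ^ (d + 4)" "ln l"] by simp
  also have "\<dots> \<le> exp (exp l)" using * by simp
  finally show ?thesis .
qed

section \<open>Radii of the cutoffs\<close>

text \<open>Level from which the test function vanishes on the k-dimensional faces; \<open>D\<close>
  stands for d + 1. The increment is \<open>Q\<close> times the bound D R^2 for the mass on the next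
  faces, R being the previous radius.\<close>

primrec cutoff_radius :: "nat \<Rightarrow> nat \<Rightarrow> nat \<Rightarrow> nat" where
  "cutoff_radius D Q 0 = 1"
| "cutoff_radius D Q (Suc k) = cutoff_radius D Q k + Q * D * (cutoff_radius D Q k)\<^sup>2"

lemma cutoff_radius_pos: "0 < cutoff_radius D Q k"
  by (induction k) auto

lemma cutoff_radius_mono: "k \<le> l \<Longrightarrow> cutoff_radius D Q k \<le> cutoff_radius D Q l"
  by (rule lift_Suc_mono_le[of "cutoff_radius D Q"]) auto

text \<open>Multiplying the radius by Q^2 absorbs the constants of the recursion: the product at
  most squares at each step, starting from Q^2.\<close>

lemma cutoff_radius_le:
  assumes "D + 1 \<le> Q"
  shows "Q\<^sup>2 * cutoff_radius D Q k \<le> Q ^ (2 ^ (k + 1))"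
proof (induction k)
  case (Suc k)
  define R where "R = cutoff_radius D Q k"
  have R: "0 < R" by (simp add: R_def cutoff_radius_pos)
  have "R + Q * D * R\<^sup>2 \<le> Q * R\<^sup>2 + Q * D * R\<^sup>2"
    using R assms by (simp add: power2_eq_square)
  also have "\<dots> = Q * (D + 1) * R\<^sup>2" by (simp add: algebra_simps)
  also have "\<dots> \<le> Q * Q * R\<^sup>2" using assms by (intro mult_mono) auto
  finally have "Q\<^sup>2 * (R + Q * D * R\<^sup>2) \<le> (Q\<^sup>2 * R)\<^sup>2"
    by (simp add: power2_eq_square mult_ac)
  also have "\<dots> \<le> (Q ^ (2 ^ (k + 1)))\<^sup>2" using Suc by (intro power_mono) (auto simp: R_def)
  also have "\<dots> = Q ^ (2 ^ (Suc k + 1))" by (simp add: mult_ac flip: power_mult)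
  finally show ?case by (simp add: R_def)
qed simp

lemma cutoff_radius_iterated_log:
  fixes d t :: nat
  defines "l \<equiv> (ln ^^ (2*d+2)) (real t)"
  assumes d: "d \<ge> 1" and t: "real t > (exp ^^ (5*d+4)) 1"
  obtains Q where "0 < Q" "0 < l" "real (d + 1) * l\<^sup>2 \<le> real Q"
    "cutoff_radius (d + 1) Q (d + 1) \<le> t"
proof
  \<comment> \<open>Of the 5d+4 exponentials below \<open>t\<close>, the logarithms undo 2d+2; the
    other 3d+2 make \<open>l\<close> large compared with \<open>d\<close>.\<close>
  have index: "3*d+2 + (2*d+2) = 5*d+4" by simp
  \<comment> \<open>This size makes the final error (d+1)/Q at most 1/l^2, while \<open>Q\<close>
    stays polynomial in \<open>l\<close>.\<close>
  define Q where "Q = nat \<lceil>real (d + 1) * l\<^sup>2\<rceil>"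
  have "(exp ^^ (3*d+2)) 1 < l"
    unfolding l_def using t ln_funpow_gt[of "3*d+2" "2*d+2" "real t"]
    by (simp only: index)
  then have "2 ^ (3*d+2) < l"
    using power2_le_exp_funpow[of "3*d+2"] by linarith
  moreover have "2 * d + 8 \<le> (2::nat) ^ (3*d+2)"
    using d by (induction d rule: dec_induct) (auto simp: power_add)
  then have "2 * real d + 8 \<le> 2 ^ (3*d+2)"
    by (metis (mono_tags, lifting) of_nat_add of_nat_le_iff of_nat_mult of_nat_numeral of_nat_power)
  ultimately have l: "2 * real d + 8 \<le> l" by linarith
  then show "0 < l" by linarith
  show Q_ge: "real (d + 1) * l\<^sup>2 \<le> real Q" unfolding Q_def by (rule of_nat_ceiling)
  have "l \<le> l\<^sup>2" using l by (simp add: power2_eq_square)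
  moreover have "l\<^sup>2 \<le> real (d + 1) * l\<^sup>2" by (simp add: distrib_right)
  ultimately have Ql: "l \<le> real Q" using Q_ge by linarith
  with l have "real (d + 2) \<le> real Q" by simp
  then have dQ: "d + 1 + 1 \<le> Q" by linarith
  then show "0 < Q" by simp
  have "real Q \<le> real (d + 1) * l\<^sup>2 + 1"
    unfolding Q_def by (simp add: ceiling_le_iff)
  also have "\<dots> \<le> real (d + 1) * l\<^sup>2 + l\<^sup>2" using \<open>l \<le> l\<^sup>2\<close> l by simp
  also have "\<dots> = real (d + 2) * l\<^sup>2" by (simp add: algebra_simps)
  also have "\<dots> \<le> l\<^sup>2 * l\<^sup>2" using \<open>l \<le> l\<^sup>2\<close> l by (intro mult_right_mono) auto
  finally have Q_le: "real Q \<le> l ^ 4" by (simp add: power2_eq_square power4_eq_xxxx mult_ac)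
  have "cutoff_radius (d+1) Q (d+1) \<le> Q\<^sup>2 * cutoff_radius (d+1) Q (d+1)" using dQ by simp
  also have "\<dots> \<le> Q ^ (2 ^ (d + 2))" using cutoff_radius_le[OF dQ, of "d + 1"] by simp
  finally have "real (cutoff_radius (d+1) Q (d+1)) \<le> real Q ^ (2 ^ (d + 2))"
    by (metis of_nat_le_iff of_nat_power)
  also have "\<dots> \<le> (l ^ 4) ^ (2 ^ (d + 2))" using Q_le by (intro power_mono) auto
  also have "\<dots> = l ^ (2 ^ (d + 4))" by (simp add: power_add mult.commute flip: power_mult)
  also have "\<dots> \<le> exp (exp l)" by (rule power_two_power_le_exp_exp[OF l])
  \<comment> \<open>Together with the two exponentials already present, these 2d rebuild
    \<open>t\<close> from its iterated logarithm \<open>l\<close>.\<close>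
  also have "\<dots> \<le> (exp ^^ (2*d)) (exp (exp l))" by (rule le_exp_funpow)
  also have "\<dots> = (exp ^^ (2*d+2)) l" by (simp add: funpow_swap1)
  also have "\<dots> = real t"
  proof -
    have "(exp ^^ (2*d+2)) 1 \<le> (exp ^^ (3*d+2)) ((exp ^^ (2*d+2)) (1::real))"
      by (rule le_exp_funpow)
    also have "\<dots> = (exp ^^ (5*d+4)) 1"
      by (simp only: index flip: funpow_add[THEN fun_cong, unfolded o_apply])
    finally show ?thesis unfolding l_def using t by (intro exp_funpow_ln_funpow) linarith
  qed
  finally show "cutoff_radius (d + 1) Q (d + 1) \<le> t" by (simp only: of_nat_le_iff)
qed

section \<open>Levels, parents and faces of the orthant\<close>

lemma finite_gb_level: "finite (gb_level d t)"
proof (rule finite_subset)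
  show "gb_level d t \<subseteq> {f. \<forall>x. (x \<in> {..d} \<longrightarrow> f x \<in> {..t}) \<and> (x \<notin> {..d} \<longrightarrow> f x = 0)}"
    by (auto simp: gb_level_def gb_pts_def intro: member_le_sum)
  show "finite {f. \<forall>x. (x \<in> {..d} \<longrightarrow> f x \<in> {..t}) \<and> (x \<notin> {..d} \<longrightarrow> f x = (0::nat))}"
    by (rule finite_set_of_finite_funs) auto
qed

lemma gb_level_0: "gb_level d 0 = {\<lambda>_. 0}"
  by (auto simp: gb_level_def gb_pts_def fun_eq_iff) (meson atMost_iff not_le)

lemma gb_level_sum: "v \<in> gb_level d t \<Longrightarrow> (\<Sum>i\<le>d. v i) = t"
  by (simp add: gb_level_def)

lemma finite_gb_parents: "finite (gb_parents d v)"
  by (simp add: gb_parents_def)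

text \<open>Lowering different positive coordinates gives different points. The number of parents is
  therefore the dimension of the face whose relative interior contains \<open>v\<close>.\<close>

lemma card_gb_parents: "card (gb_parents d v) = card {i. i \<le> d \<and> 0 < v i}"
proof -
  have "inj_on (\<lambda>i. v(i := v i - 1)) {i. i \<le> d \<and> 0 < v i}"
    by (auto simp: inj_on_def fun_eq_iff split: if_splits)
  then show ?thesis by (simp add: gb_parents_def card_image)
qed

lemma card_gb_parents_le: "card (gb_parents d v) \<le> d + 1"
  using card_mono[of "{..d}" "{i. i \<le> d \<and> 0 < v i}"] by (auto simp: card_gb_parents)

lemma card_gb_parents_pos:
  assumes "v \<in> gb_level d (Suc s)"
  shows "0 < card (gb_parents d v)"
proof -
  have "(\<Sum>i\<le>d. v i) \<noteq> 0" using assms by (simp add: gb_level_def)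
  then obtain i where "i \<le> d" "0 < v i" by auto
  then show ?thesis by (auto simp: card_gb_parents card_gt_0_iff)
qed

lemma gb_parentsE:
  assumes "u \<in> gb_parents d v"
  obtains i where "i \<le> d" "v = u(i := Suc (u i))"
  using assms by (auto simp: gb_parents_def)

lemma gb_parents_level:
  assumes "v \<in> gb_level d (Suc s)" "u \<in> gb_parents d v"
  shows "u \<in> gb_level d s"
proof -
  obtain i where i: "i \<le> d" "v = u(i := Suc (u i))" using gb_parentsE[OF assms(2)] .
  have "(\<Sum>j\<le>d. v j) = v i + (\<Sum>j\<in>{..d} - {i}. v j)" using i by (intro sum.remove) auto
  also have "\<dots> = Suc (u i + (\<Sum>j\<in>{..d} - {i}. u j))" using i by simp
  also have "u i + (\<Sum>j\<in>{..d} - {i}. u j) = (\<Sum>j\<le>d. u j)"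
    using i by (intro sum.remove[symmetric]) auto
  finally show ?thesis using assms(1) i by (auto simp: gb_level_def gb_pts_def split: if_splits)
qed

text \<open>Raising a positive coordinate stays inside the face; raising a zero coordinate enters a
  face of one dimension more.\<close>

lemma card_gb_parents_child:
  assumes "i \<le> d"
  shows "card (gb_parents d (u(i := Suc (u i)))) = (if 0 < u i then card (gb_parents d u) else Suc (card (gb_parents d u)))"
proof -
  have "{j. j \<le> d \<and> 0 < (u(i := Suc (u i))) j} = insert i {j. j \<le> d \<and> 0 < u j}"
    using assms by auto
  moreover have "finite {j. j \<le> d \<and> 0 < u j}" by simp
  ultimately show ?thesis using assms by (simp add: card_gb_parents insert_absorb)
qed

lemma card_gb_parents_cases:
  assumes "u \<in> gb_parents d v"
  obtains "card (gb_parents d u) = card (gb_parents d v)"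
  | "card (gb_parents d v) = Suc (card (gb_parents d u))"
  using assms by (metis gb_parentsE card_gb_parents_child)

text \<open>A child inside the same face comes from raising one of the positive coordinates. Against
  weights \<alpha>_k \<le> 1/k this count is what keeps mass from growing inside a face.\<close>

lemma card_gb_children_same:
  "card {v \<in> A. u \<in> gb_parents d v \<and> card (gb_parents d v) = card (gb_parents d u)} \<le> card (gb_parents d u)"
proof -
  have "{v \<in> A. u \<in> gb_parents d v \<and> card (gb_parents d v) = card (gb_parents d u)}
      \<subseteq> (\<lambda>i. u(i := Suc (u i))) ` {i. i \<le> d \<and> 0 < u i}"
    by (auto elim!: gb_parentsE simp: card_gb_parents_child split: if_splits)
  then have "card {v \<in> A. u \<in> gb_parents d v \<and> card (gb_parents d v) = card (gb_parents d u)}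
      \<le> card {i. i \<le> d \<and> 0 < u i}"
    by (rule surj_card_le[rotated]) simp
  then show ?thesis by (simp add: card_gb_parents)
qed

lemma card_gb_children_le: "card {v \<in> A. u \<in> gb_parents d v \<and> P v} \<le> d + 1"
proof -
  have "{v \<in> A. u \<in> gb_parents d v \<and> P v} \<subseteq> (\<lambda>i. u(i := Suc (u i))) ` {..d}"
    by (auto elim!: gb_parentsE)
  then have "card {v \<in> A. u \<in> gb_parents d v \<and> P v} \<le> card {..d}"
    by (rule surj_card_le[rotated]) simp
  then show ?thesis by simp
qed

section \<open>Duality between top-level coefficients and defects\<close>

text \<open>Split each top-level value into its defect and the weighted sum over its parents;
  exchanging the sums pushes the latter to coefficients one level down. \<open>A\<close> is chosen
  before \<open>\<phi>\<close>, so the same weights apply to the random field and to the test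
  function.\<close>

lemma gb_adjoint_recursion:
  fixes a :: "(nat \<Rightarrow> nat) \<Rightarrow> real"
  shows "\<exists>A. \<forall>\<phi>. (\<Sum>v\<in>gb_level d t. a v * \<phi> v) =
      A 0 (\<lambda>_. 0) * \<phi> (\<lambda>_. 0) +
      (\<Sum>s<t. \<Sum>v\<in>gb_level d (Suc s). A (Suc s) v *
        (\<phi> v - \<alpha> (card (gb_parents d v)) * (\<Sum>u\<in>gb_parents d v. \<phi> u)))"
proof (induction t arbitrary: a)
  case 0
  show ?case by (rule exI[of _ "\<lambda>_. a"]) (simp add: gb_level_0)
next
  case (Suc t)
  define b where "b v = a v * \<alpha> (card (gb_parents d v))" for v
  define a' where "a' u = (\<Sum>v | v \<in> gb_level d (Suc t) \<and> u \<in> gb_parents d v. b v)" for u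
  obtain A where A: "\<forall>\<phi>. (\<Sum>v\<in>gb_level d t. a' v * \<phi> v) = A 0 (\<lambda>_. 0) * \<phi> (\<lambda>_. 0) +
      (\<Sum>s<t. \<Sum>v\<in>gb_level d (Suc s). A (Suc s) v *
        (\<phi> v - \<alpha> (card (gb_parents d v)) * (\<Sum>u\<in>gb_parents d v. \<phi> u)))"
    using Suc.IH[of a'] by (rule exE)
  have swap: "(\<Sum>v\<in>gb_level d (Suc t). b v * (\<Sum>u\<in>gb_parents d v. \<phi> u))
      = (\<Sum>u\<in>gb_level d t. a' u * \<phi> u)" for \<phi>
  proof -
    have "(\<Sum>v\<in>gb_level d (Suc t). b v * (\<Sum>u\<in>gb_parents d v. \<phi> u))
        = (\<Sum>v\<in>gb_level d (Suc t). \<Sum>u | u \<in> gb_level d t \<and> u \<in> gb_parents d v. b v * \<phi> u)"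
    proof (rule sum.cong[OF refl])
      fix v assume "v \<in> gb_level d (Suc t)"
      then have "{u. u \<in> gb_level d t \<and> u \<in> gb_parents d v} = gb_parents d v"
        using gb_parents_level by blast
      then show "b v * (\<Sum>u\<in>gb_parents d v. \<phi> u)
          = (\<Sum>u | u \<in> gb_level d t \<and> u \<in> gb_parents d v. b v * \<phi> u)"
        by (simp add: sum_distrib_left)
    qed
    also have "\<dots> = (\<Sum>u\<in>gb_level d t. \<Sum>v | v \<in> gb_level d (Suc t) \<and> u \<in> gb_parents d v. b v * \<phi> u)"
      by (rule sum.swap_restrict) (auto simp: finite_gb_level)
    finally show ?thesis by (simp add: a'_def sum_distrib_right)
  qed
  \<comment> \<open>The lower identity reads \<open>A\<close> only at levels up to \<open>t\<close>,
    so the new top level can be overwritten by \<open>a\<close>.\<close>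
  show ?case
  proof (intro exI[of _ "A(Suc t := a)"] allI)
    fix \<phi> :: "(nat \<Rightarrow> nat) \<Rightarrow> real"
    have "(\<Sum>v\<in>gb_level d (Suc t). a v * \<phi> v) =
        (\<Sum>v\<in>gb_level d (Suc t). a v * (\<phi> v - \<alpha> (card (gb_parents d v)) * (\<Sum>u\<in>gb_parents d v. \<phi> u)))
        + (\<Sum>v\<in>gb_level d (Suc t). b v * (\<Sum>u\<in>gb_parents d v. \<phi> u))"
      by (simp add: b_def algebra_simps flip: sum.distrib)
    then show "(\<Sum>v\<in>gb_level d (Suc t). a v * \<phi> v) =
      (A(Suc t := a)) 0 (\<lambda>_. 0) * \<phi> (\<lambda>_. 0) +
      (\<Sum>s<Suc t. \<Sum>v\<in>gb_level d (Suc s). (A(Suc t := a)) (Suc s) v *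
        (\<phi> v - \<alpha> (card (gb_parents d v)) * (\<Sum>u\<in>gb_parents d v. \<phi> u)))"
      unfolding swap A[rule_format] by simp
  qed
qed

section \<open>Linear cutoffs in the level\<close>

text \<open>The cutoff for dimension \<open>k + 1\<close> is constantly 1 up to radius \<open>R k\<close>, beyond which the
  lower faces vanish, and then decreases linearly to 0 over \<open>Q D (R k)^2\<close> levels; the mass on that
  face turns out to be at most \<open>D (R k)^2\<close>.\<close>

definition cutoff :: "nat \<Rightarrow> nat \<Rightarrow> nat \<Rightarrow> nat \<Rightarrow> real" where
  "cutoff D Q k s = (case k of 0 \<Rightarrow> if s = 0 then 1 else 0
    | Suc j \<Rightarrow> max 0 (min 1
        ((real (cutoff_radius D Q (Suc j)) - real s) / real (Q * D * (cutoff_radius D Q j)\<^sup>2))))"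

lemma cutoff_nonneg: "0 \<le> cutoff D Q k s"
  by (simp add: cutoff_def split: nat.split)

lemma cutoff_le_1: "cutoff D Q k s \<le> 1"
  by (simp add: cutoff_def split: nat.split)

lemma cutoff_eq_0: "cutoff_radius D Q k \<le> s \<Longrightarrow> cutoff D Q k s = 0"
proof (cases k)
  case (Suc j)
  assume s: "cutoff_radius D Q k \<le> s"
  have "(real (cutoff_radius D Q (Suc j)) - real s) / real (Q * D * (cutoff_radius D Q j)\<^sup>2) \<le> 0"
    using s Suc by (intro divide_nonpos_nonneg) (simp_all del: cutoff_radius.simps)
  with Suc show ?thesis by (simp add: cutoff_def del: cutoff_radius.simps of_nat_mult of_nat_power)
qed (auto simp: cutoff_def)

lemma cutoff_Suc_eq_1:
  assumes "0 < Q * D" "s \<le> cutoff_radius D Q k"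
  shows "cutoff D Q (Suc k) s = 1"
proof -
  have pos: "0 < real (Q * D * (cutoff_radius D Q k)\<^sup>2)"
    using assms(1) cutoff_radius_pos[of D Q k] by simp
  have "real (Q * D * (cutoff_radius D Q k)\<^sup>2) \<le> real (cutoff_radius D Q (Suc k)) - real s"
    using assms(2) by (simp add: of_nat_diff flip: of_nat_add of_nat_mult of_nat_power)
  with pos show ?thesis by (simp add: cutoff_def del: of_nat_mult of_nat_power cutoff_radius.simps)
qed

text \<open>Up to the k-th radius the next cutoff is 1, and beyond it the k-th cutoff is 0.\<close>

lemma cutoff_mult_Suc:
  assumes "0 < Q * D"
  shows "cutoff D Q (Suc k) s * cutoff D Q k s = cutoff D Q k s"
  using cutoff_eq_0[of D Q k s] cutoff_Suc_eq_1[OF assms, of s k] by (cases "s \<le> cutoff_radius D Q k") auto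

lemma cutoff_Suc_step:
  assumes "0 < Q * D"
  shows "0 \<le> cutoff D Q (Suc k) s - cutoff D Q (Suc k) (Suc s)"
    and "cutoff D Q (Suc k) s - cutoff D Q (Suc k) (Suc s) \<le> 1 / real (Q * D * (cutoff_radius D Q k)\<^sup>2)"
proof -
  define m where "m = real (Q * D * (cutoff_radius D Q k)\<^sup>2)"
  have m: "0 < m" using assms cutoff_radius_pos[of D Q k] by (simp add: m_def)
  define x where "x = (real (cutoff_radius D Q (Suc k)) - real s) / m"
  have 0: "cutoff D Q (Suc k) s = max 0 (min 1 x)"
    unfolding cutoff_def x_def m_def by simp
  have 1: "cutoff D Q (Suc k) (Suc s) = max 0 (min 1 (x - 1 / m))"
    unfolding cutoff_def x_def
    by (simp only: nat.case m_def[symmetric] of_nat_Suc diff_diff_eq flip: diff_divide_distrib) (simp only: add.commute)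
  have "0 < 1 / m" using m by simp
  then show "0 \<le> cutoff D Q (Suc k) s - cutoff D Q (Suc k) (Suc s)"
    "cutoff D Q (Suc k) s - cutoff D Q (Suc k) (Suc s) \<le> 1 / real (Q * D * (cutoff_radius D Q k)\<^sup>2)"
    unfolding 0 1 m_def[symmetric] by linarith+
qed

text \<open>Each squared step is at most the largest step times the step itself; the steps telescope
  to a total drop of at most 1.\<close>

lemma sum_cutoff_step_power2_le:
  assumes "0 < Q * D"
  shows "(\<Sum>s<t. (cutoff D Q (Suc k) (Suc s) - cutoff D Q (Suc k) s)\<^sup>2)
    \<le> 1 / real (Q * D * (cutoff_radius D Q k)\<^sup>2)"
proof -
  define m where "m = 1 / real (Q * D * (cutoff_radius D Q k)\<^sup>2)"
  let ?c = "cutoff D Q (Suc k)"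
  have "(\<Sum>s<t. (?c (Suc s) - ?c s)\<^sup>2) \<le> (\<Sum>s<t. m * (?c s - ?c (Suc s)))"
  proof (rule sum_mono)
    fix s
    have "(?c s - ?c (Suc s)) * (?c s - ?c (Suc s)) \<le> m * (?c s - ?c (Suc s))"
      unfolding m_def by (intro mult_right_mono cutoff_Suc_step assms)
    then show "(?c (Suc s) - ?c s)\<^sup>2 \<le> m * (?c s - ?c (Suc s))"
      by (simp add: power2_eq_square algebra_simps)
  qed
  also have "\<dots> = m * (?c 0 - ?c t)"
    by (simp add: sum_lessThan_telescope' flip: sum_distrib_left)
  also have "\<dots> \<le> m * 1"
    using cutoff_le_1[of D Q "Suc k" 0] cutoff_nonneg[of D Q "Suc k" t]
    by (intro mult_left_mono) (auto simp: m_def)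
  finally show ?thesis by (simp add: m_def)
qed

section \<open>Harmonic extension along faces and its mass per level\<close>

text \<open>Only contributions entering from a lower face are cut off here, so that \<open>gb_eta\<close> is
  harmonic inside each face.\<close>

primrec gb_eta :: "(nat \<Rightarrow> nat \<Rightarrow> real) \<Rightarrow> (nat \<Rightarrow> real) \<Rightarrow> nat \<Rightarrow> nat \<Rightarrow> (nat \<Rightarrow> nat) \<Rightarrow> real" where
  "gb_eta \<kappa> \<alpha> d 0 v = 1"
| "gb_eta \<kappa> \<alpha> d (Suc s) v = \<alpha> (card (gb_parents d v)) *
    (\<Sum>u\<in>gb_parents d v.
      (if card (gb_parents d u) = card (gb_parents d v) then 1 else \<kappa> (card (gb_parents d u)) s)
      * gb_eta \<kappa> \<alpha> d s u)"

text \<open>Isolates what the recursion for \<open>gb_eta\<close> needs from a cutoff: values in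
  [0,1] and nesting between consecutive dimensions. Radii and the linear shape enter only in
  \<open>gb_test_function\<close>.\<close>

locale gb_cutoff =
  fixes \<kappa> :: "nat \<Rightarrow> nat \<Rightarrow> real" and \<alpha> :: "nat \<Rightarrow> real" and d :: nat
  assumes \<kappa>_nonneg: "0 \<le> \<kappa> k s" and \<kappa>_le_1: "\<kappa> k s \<le> 1"
    and \<kappa>_mult_Suc: "\<kappa> (Suc k) s * \<kappa> k s = \<kappa> k s"
    and \<alpha>_pos: "i \<in> {1..d+1} \<Longrightarrow> 0 < \<alpha> i"
    and \<alpha>_le: "i \<in> {1..d+1} \<Longrightarrow> \<alpha> i \<le> 1 / real i"
begin

abbreviation "eta \<equiv> gb_eta \<kappa> \<alpha> d"

abbreviation "npar v \<equiv> card (gb_parents d v)"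

lemma npar_range: "v \<in> gb_level d (Suc s) \<Longrightarrow> npar v \<in> {1..d+1}"
  using card_gb_parents_pos card_gb_parents_le by fastforce

text \<open>With k parents, the new value is \<alpha>_k \<le> 1/k times a sum of k terms in
  [0,1].\<close>

lemma eta_bounds:
  assumes "v \<in> gb_level d s"
  shows "0 \<le> eta s v \<and> eta s v \<le> 1"
  using assms
proof (induction s arbitrary: v)
  case (Suc s)
  let ?w = "\<lambda>u. if npar u = npar v then 1 else \<kappa> (npar u) s"
  have w: "0 \<le> ?w u * eta s u \<and> ?w u * eta s u \<le> 1" if "u \<in> gb_parents d v" for u
    using Suc.IH[OF gb_parents_level[OF Suc.prems that]] \<kappa>_nonneg \<kappa>_le_1
    by (auto intro!: mult_le_one)
  have a: "0 < \<alpha> (npar v)" "\<alpha> (npar v) \<le> 1 / real (npar v)"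
    using \<alpha>_pos \<alpha>_le npar_range[OF Suc.prems] by auto
  have "\<alpha> (npar v) * (\<Sum>u\<in>gb_parents d v. ?w u * eta s u) \<le> 1 / real (npar v) * (\<Sum>u\<in>gb_parents d v. 1)"
    using w a by (intro mult_mono sum_mono sum_nonneg) auto
  also have "\<dots> \<le> 1" by simp
  finally show ?case using w a by (simp del: mult_eq_if add: mult_nonneg_nonneg sum_nonneg)
qed simp

text \<open>A parent has either as many positive coordinates as its child or one fewer; in the second
  case the cutoff of the child's face is still 1 wherever the cutoff of the parent's face is nonzero.\<close>

lemma eta_defect:
  assumes "v \<in> gb_level d (Suc s)"
  shows "\<kappa> (npar v) (Suc s) * eta (Suc s) v -
      \<alpha> (npar v) * (\<Sum>u\<in>gb_parents d v. \<kappa> (npar u) s * eta s u)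
    = (\<kappa> (npar v) (Suc s) - \<kappa> (npar v) s) * eta (Suc s) v"
proof -
  have "\<kappa> (npar u) s * eta s u =
      \<kappa> (npar v) s * ((if npar u = npar v then 1 else \<kappa> (npar u) s) * eta s u)"
    if "u \<in> gb_parents d v" for u
    using that by (cases rule: card_gb_parents_cases) (simp_all add: \<kappa>_mult_Suc flip: mult.assoc)
  then have "(\<Sum>u\<in>gb_parents d v. \<kappa> (npar u) s * eta s u) = \<kappa> (npar v) s *
      (\<Sum>u\<in>gb_parents d v. (if npar u = npar v then 1 else \<kappa> (npar u) s) * eta s u)"
    unfolding sum_distrib_left by (rule sum.cong[OF refl])
  then show ?thesis by (simp only: gb_eta.simps left_diff_distrib right_diff_distrib mult.left_commute)
qed

definition mass :: "nat \<Rightarrow> nat \<Rightarrow> real" where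
  "mass k s = (\<Sum>v | v \<in> gb_level d s \<and> npar v = k. eta s v)"

lemma mass_0: "mass k 0 = (if k = 0 then 1 else 0)"
proof -
  have "npar (\<lambda>_. 0) = 0" by (simp add: card_gb_parents)
  then have "{v. v \<in> gb_level d 0 \<and> npar v = k} = (if k = 0 then {\<lambda>_. 0} else {})"
    by (auto simp: gb_level_0)
  then show ?thesis by (simp add: mass_def)
qed

lemma mass_0_Suc: "mass 0 (Suc s) = 0"
  unfolding mass_def using card_gb_parents_pos[of _ d s] by (intro sum.neutral ballI) fastforce

lemma mass_nonneg: "0 \<le> mass k s"
  unfolding mass_def using eta_bounds by (intro sum_nonneg) auto

text \<open>A point of the same dimension passes its value to at most k+1 children of that
  dimension, with weight at most 1/(k+1) each, so this contribution does not grow. A point one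
  dimension lower feeds at most d+1 children with weight at most 1, after its value is cut
  off.\<close>

lemma mass_Suc_le:
  assumes "Suc k \<le> d + 1"
  shows "mass (Suc k) (Suc s) \<le> mass (Suc k) s + real (d + 1) * \<kappa> k s * mass k s"
proof -
  let ?L = "gb_level d (Suc s)"
  let ?w = "\<lambda>u. if npar u = Suc k then 1 else \<kappa> (npar u) s"
  let ?ch = "\<lambda>u. {v \<in> {v. v \<in> ?L \<and> npar v = Suc k}. u \<in> gb_parents d v}"
  let ?P = "{u \<in> gb_level d s. npar u = Suc k \<or> npar u = k}"
  have a: "0 < \<alpha> (Suc k)" "\<alpha> (Suc k) \<le> 1 / real (Suc k)" using \<alpha>_pos[of "Suc k"] \<alpha>_le[of "Suc k"] assms by auto
  have fin: "finite ?P" "finite {v. v \<in> ?L \<and> npar v = Suc k}"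
    using finite_gb_level[of d s] finite_gb_level[of d "Suc s"] by auto
  have "mass (Suc k) (Suc s) = (\<Sum>v | v \<in> ?L \<and> npar v = Suc k.
      \<Sum>u | u \<in> ?P \<and> u \<in> gb_parents d v. \<alpha> (Suc k) * (?w u * eta s u))"
    unfolding mass_def
  proof (intro sum.cong refl)
    fix v assume v: "v \<in> {v. v \<in> ?L \<and> npar v = Suc k}"
    have "{u. u \<in> ?P \<and> u \<in> gb_parents d v} = gb_parents d v"
      using v gb_parents_level[of v d s] by (auto elim: card_gb_parents_cases)
    with v show "eta (Suc s) v = (\<Sum>u | u \<in> ?P \<and> u \<in> gb_parents d v. \<alpha> (Suc k) * (?w u * eta s u))"
      by (simp add: sum_distrib_left)
  qed
  \<comment> \<open>Exchanging the sums replaces counting parents by counting children.\<close>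
  also have "\<dots> = (\<Sum>u\<in>?P. \<Sum>v\<in>?ch u. \<alpha> (Suc k) * (?w u * eta s u))"
    using fin by (subst sum.swap_restrict) auto
  also have "\<dots> = (\<Sum>u\<in>?P. real (card (?ch u)) * \<alpha> (Suc k) * (?w u * eta s u))"
    by (simp only: sum_constant mult.assoc)
  also have "\<dots> = (\<Sum>u | u \<in> gb_level d s \<and> npar u = Suc k. real (card (?ch u)) * \<alpha> (Suc k) * eta s u)
      + (\<Sum>u | u \<in> gb_level d s \<and> npar u = k. real (card (?ch u)) * \<alpha> (Suc k) * (\<kappa> k s * eta s u))"
  proof -
    have "?P = {u. u \<in> gb_level d s \<and> npar u = Suc k} \<union> {u. u \<in> gb_level d s \<and> npar u = k}" by auto
    then show ?thesis using finite_gb_level[of d s] by (simp only:, subst sum.union_disjoint) auto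
  qed
  also have "\<dots> \<le> (\<Sum>u | u \<in> gb_level d s \<and> npar u = Suc k. 1 * eta s u)
      + (\<Sum>u | u \<in> gb_level d s \<and> npar u = k. real (d + 1) * (\<kappa> k s * eta s u))"
  proof (intro add_mono sum_mono mult_right_mono)
    fix u assume u: "u \<in> {u. u \<in> gb_level d s \<and> npar u = Suc k}"
    have "?ch u = {v \<in> ?L. u \<in> gb_parents d v \<and> npar v = npar u}" using u by auto
    then have "real (card (?ch u)) \<le> real (Suc k)" using card_gb_children_same[of ?L u d] u by simp
    then have "real (card (?ch u)) * \<alpha> (Suc k) \<le> real (Suc k) * (1 / real (Suc k))"
      using a by (intro mult_mono) auto
    then show "real (card (?ch u)) * \<alpha> (Suc k) \<le> 1" by simp
    show "0 \<le> eta s u" using eta_bounds u by auto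
  next
    fix u assume u: "u \<in> {u. u \<in> gb_level d s \<and> npar u = k}"
    have "real (card (?ch u)) \<le> real (d + 1)"
      using card_gb_children_le[of "{v. v \<in> ?L \<and> npar v = Suc k}" u d "\<lambda>_. True"] by simp
    moreover have "\<alpha> (Suc k) \<le> 1" using a by (simp add: order_trans)
    ultimately have "real (card (?ch u)) * \<alpha> (Suc k) \<le> real (d + 1) * 1" using a by (intro mult_mono) auto
    then show "real (card (?ch u)) * \<alpha> (Suc k) \<le> real (d + 1)" by simp
    show "0 \<le> \<kappa> k s * eta s u" using eta_bounds u \<kappa>_nonneg by auto
  qed
  finally show ?thesis by (simp add: mass_def sum_distrib_left mult_ac)
qed

text \<open>Iterates the one-step bound from zero mass at level 0. Once \<kappa> has bounded support
  in the level, the right side is bounded uniformly in \<open>s\<close>.\<close>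

lemma mass_le_sum:
  assumes "Suc k \<le> d + 1"
  shows "mass (Suc k) s \<le> real (d + 1) * (\<Sum>r<s. \<kappa> k r * mass k r)"
proof (induction s)
  case (Suc s)
  then show ?case using mass_Suc_le[OF assms, of s] by (simp add: algebra_simps)
qed (simp add: mass_0)

text \<open>Since 0 \<le> \<eta> \<le> 1, squares of \<eta> are dominated by \<eta> itself; grouping
  the points by dimension then yields masses.\<close>

lemma defect_power2_sum_le:
  "(\<Sum>s<t. \<Sum>v\<in>gb_level d (Suc s). ((\<kappa> (npar v) (Suc s) - \<kappa> (npar v) s) * eta (Suc s) v)\<^sup>2)
    \<le> (\<Sum>k\<in>{1..d+1}. \<Sum>s<t. (\<kappa> k (Suc s) - \<kappa> k s)\<^sup>2 * mass k (Suc s))"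
proof -
  have "(\<Sum>v\<in>gb_level d (Suc s). ((\<kappa> (npar v) (Suc s) - \<kappa> (npar v) s) * eta (Suc s) v)\<^sup>2)
      \<le> (\<Sum>k\<in>{1..d+1}. (\<kappa> k (Suc s) - \<kappa> k s)\<^sup>2 * mass k (Suc s))" for s
  proof -
    let ?L = "gb_level d (Suc s)"
    have "(\<Sum>v\<in>?L. ((\<kappa> (npar v) (Suc s) - \<kappa> (npar v) s) * eta (Suc s) v)\<^sup>2)
        \<le> (\<Sum>v\<in>?L. (\<kappa> (npar v) (Suc s) - \<kappa> (npar v) s)\<^sup>2 * eta (Suc s) v)"
    proof (rule sum_mono)
      fix v assume "v \<in> ?L"
      then have "0 \<le> eta (Suc s) v \<and> eta (Suc s) v \<le> 1" by (rule eta_bounds)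
      then have "eta (Suc s) v * eta (Suc s) v \<le> 1 * eta (Suc s) v" by (intro mult_right_mono) auto
      then show "((\<kappa> (npar v) (Suc s) - \<kappa> (npar v) s) * eta (Suc s) v)\<^sup>2
          \<le> (\<kappa> (npar v) (Suc s) - \<kappa> (npar v) s)\<^sup>2 * eta (Suc s) v"
        unfolding power_mult_distrib by (intro mult_left_mono) (auto simp: power2_eq_square)
    qed
    also have "\<dots> = (\<Sum>k\<in>{1..d+1}. \<Sum>v | v \<in> ?L \<and> npar v = k.
        (\<kappa> (npar v) (Suc s) - \<kappa> (npar v) s)\<^sup>2 * eta (Suc s) v)"
      using npar_range by (intro sum.group[symmetric] finite_gb_level) auto
    also have "\<dots> = (\<Sum>k\<in>{1..d+1}. (\<kappa> k (Suc s) - \<kappa> k s)\<^sup>2 * mass k (Suc s))"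
      by (simp add: mass_def sum_distrib_left)
    finally show ?thesis .
  qed
  then have "(\<Sum>s<t. \<Sum>v\<in>gb_level d (Suc s). ((\<kappa> (npar v) (Suc s) - \<kappa> (npar v) s) * eta (Suc s) v)\<^sup>2)
    \<le> (\<Sum>s<t. \<Sum>k\<in>{1..d+1}. (\<kappa> k (Suc s) - \<kappa> k s)\<^sup>2 * mass k (Suc s))" by (rule sum_mono)
  also have "\<dots> = (\<Sum>k\<in>{1..d+1}. \<Sum>s<t. (\<kappa> k (Suc s) - \<kappa> k s)\<^sup>2 * mass k (Suc s))"
    by (rule sum.swap)
  finally show ?thesis .
qed

end

section \<open>The test function and its defect\<close>

text \<open>In each positive dimension the squared cutoff steps sum to at most 1/(Q D R^2), and the
  mass is at most D R^2, where R is the previous radius. This costs 1/Q for each of the d+1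
  dimensions.\<close>

lemma gb_test_function:
  fixes d Q t :: nat and \<alpha> :: "nat \<Rightarrow> real"
  assumes \<alpha>: "\<forall>i\<in>{1..d+1}. 0 < \<alpha> i \<and> \<alpha> i \<le> 1 / real i"
    and Q: "0 < Q" and t: "cutoff_radius (d + 1) Q (d + 1) \<le> t"
  obtains \<phi> where "\<phi> (\<lambda>_. 0) = 1" "\<And>v. v \<in> gb_level d t \<Longrightarrow> \<phi> v = 0"
    "(\<Sum>s<t. \<Sum>v\<in>gb_level d (Suc s).
      (\<phi> v - \<alpha> (card (gb_parents d v)) * (\<Sum>u\<in>gb_parents d v. \<phi> u))\<^sup>2) \<le> real (d + 1) / real Q"
proof -
  let ?D = "d + 1"
  let ?R = "cutoff_radius ?D Q"
  let ?c = "cutoff ?D Q"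
  have QD: "0 < Q * ?D" using Q by simp
  interpret gb_cutoff ?c \<alpha> d
    using \<alpha> cutoff_mult_Suc[OF QD] by unfold_locales (simp_all only: cutoff_nonneg cutoff_le_1)
  \<comment> \<open>At most R levels survive the cutoff of dimension k, each with mass at most R, so
    at most D R^2 enters the next dimension.\<close>
  have mass_Suc: "mass (Suc k) s \<le> real (?D * (?R k)\<^sup>2)"
    if k: "Suc k \<le> ?D" and IH: "\<And>r. mass k r \<le> real (?R k)" for k s
  proof -
    have le: "?c k r * mass k r \<le> (if r < ?R k then real (?R k) else 0)" for r
    proof (cases "r < ?R k")
      case True
      have "?c k r * mass k r \<le> 1 * real (?R k)"
        using cutoff_le_1 mass_nonneg IH by (intro mult_mono) auto
      with True show ?thesis by simp
    qed (simp add: cutoff_eq_0)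
    have "(\<Sum>r<s. ?c k r * mass k r) \<le> (\<Sum>r<s. if r < ?R k then real (?R k) else 0)"
      by (rule sum_mono[OF le])
    also have "\<dots> = (\<Sum>r\<in>{..<s} \<inter> {r. r < ?R k}. real (?R k))"
      by (subst sum.If_cases) simp_all
    also have "\<dots> \<le> (\<Sum>r<?R k. real (?R k))"
      by (rule sum_mono2) auto
    also have "\<dots> = (real (?R k))\<^sup>2" by (simp add: power2_eq_square)
    finally have "real ?D * (\<Sum>r<s. ?c k r * mass k r) \<le> real ?D * (real (?R k))\<^sup>2"
      by (intro mult_left_mono) auto
    with mass_le_sum[OF k, of s] show ?thesis by (simp only: of_nat_mult of_nat_power)
  qed
  have mass_le: "mass k s \<le> real (?R k)" if "k \<le> ?D" for k s
    using that
  proof (induction k arbitrary: s)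
    case 0
    show ?case using mass_0[of 0] mass_0_Suc by (cases s) simp_all
  next
    case (Suc k)
    \<comment> \<open>The increment in the radius recursion dominates the new mass bound, which
      closes the induction.\<close>
    have "?D * (?R k)\<^sup>2 \<le> Q * (?D * (?R k)\<^sup>2)" using Q by simp
    also have "\<dots> \<le> ?R (Suc k)" by (simp only: cutoff_radius.simps mult.assoc le_add2)
    finally have "real (?D * (?R k)\<^sup>2) \<le> real (?R (Suc k))" by (simp only: of_nat_le_iff)
    with mass_Suc[of k s] Suc show ?case by fastforce
  qed
  define \<phi> where "\<phi> v = ?c (npar v) (\<Sum>i\<le>d. v i) * eta (\<Sum>i\<le>d. v i) v" for v
  have \<phi>: "\<phi> v = ?c (npar v) s * eta s v" if "v \<in> gb_level d s" for v s
    using gb_level_sum[OF that] by (simp add: \<phi>_def)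
  have defect: "\<phi> v - \<alpha> (npar v) * (\<Sum>u\<in>gb_parents d v. \<phi> u)
      = (?c (npar v) (Suc s) - ?c (npar v) s) * eta (Suc s) v" if "v \<in> gb_level d (Suc s)" for v s
    using eta_defect[OF that] \<phi>[OF that] \<phi>[OF gb_parents_level[OF that]] by simp
  show thesis
  proof
    show "\<phi> (\<lambda>_. 0) = 1"
      by (simp add: \<phi>_def card_gb_parents cutoff_def)
    show "\<phi> v = 0" if "v \<in> gb_level d t" for v
    proof -
      \<comment> \<open>The radii increase with the dimension, so level \<open>t\<close> lies beyond
        the cutoff on every face.\<close>
      have "?R (npar v) \<le> t"
        using cutoff_radius_mono[OF card_gb_parents_le[of d v], of ?D Q] t by linarith
      then show ?thesis using \<phi>[OF that] by (simp add: cutoff_eq_0)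
    qed
    have "(\<Sum>s<t. \<Sum>v\<in>gb_level d (Suc s). (\<phi> v - \<alpha> (npar v) * (\<Sum>u\<in>gb_parents d v. \<phi> u))\<^sup>2)
        = (\<Sum>s<t. \<Sum>v\<in>gb_level d (Suc s). ((?c (npar v) (Suc s) - ?c (npar v) s) * eta (Suc s) v)\<^sup>2)"
      by (intro sum.cong refl) (simp add: defect)
    also have "\<dots> \<le> (\<Sum>k\<in>{1..?D}. \<Sum>s<t. (?c k (Suc s) - ?c k s)\<^sup>2 * mass k (Suc s))"
      by (rule defect_power2_sum_le)
    also have "\<dots> \<le> (\<Sum>k\<in>{1..?D}. 1 / real Q)"
    proof (rule sum_mono)
      fix k assume "k \<in> {1..?D}"
      then obtain j where j: "k = Suc j" "Suc j \<le> ?D" by (cases k) auto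
      define m where "m = real (?D * (?R j)\<^sup>2)"
      have m: "0 < m"
        using cutoff_radius_pos[of ?D Q j] by (simp only: m_def of_nat_0_less_iff nat_0_less_mult_iff) simp
      have "(\<Sum>s<t. (?c k (Suc s) - ?c k s)\<^sup>2 * mass k (Suc s)) \<le> (\<Sum>s<t. (?c k (Suc s) - ?c k s)\<^sup>2 * m)"
        unfolding j m_def using j(2) mass_le by (intro sum_mono mult_left_mono mass_Suc) auto
      also have "\<dots> = (\<Sum>s<t. (?c k (Suc s) - ?c k s)\<^sup>2) * m" by (simp add: sum_distrib_right)
      also have "\<dots> \<le> 1 / real (Q * ?D * (?R j)\<^sup>2) * m"
        unfolding j using m by (intro mult_right_mono sum_cutoff_step_power2_le QD) auto
      also have "\<dots> = 1 / (real Q * m) * m" by (simp only: m_def of_nat_mult mult.assoc)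
      also have "\<dots> = 1 / real Q" using m by simp
      finally show "(\<Sum>s<t. (?c k (Suc s) - ?c k s)\<^sup>2 * mass k (Suc s)) \<le> 1 / real Q" .
    qed
    also have "\<dots> = real ?D / real Q" by simp
    finally show "(\<Sum>s<t. \<Sum>v\<in>gb_level d (Suc s).
        (\<phi> v - \<alpha> (npar v) * (\<Sum>u\<in>gb_parents d v. \<phi> u))\<^sup>2) \<le> real ?D / real Q" .
  qed
qed

section \<open>Expansion of the model in its noises\<close>

text \<open>The defect of the random field is pure noise, so putting the field into
  \<open>gb_adjoint_recursion\<close> expands \<open>\<zeta>\<close> in the root value and the edge
  noises.\<close>

lemma gb_X_defect:
  assumes "v \<in> gb_level d (Suc s)"
  shows "gb_X \<alpha> d x w v - \<alpha> (card (gb_parents d v)) * (\<Sum>u\<in>gb_parents d v. gb_X \<alpha> d x w u)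
    = \<alpha> (card (gb_parents d v)) * (\<Sum>u\<in>gb_parents d v. w (u, v))"
proof -
  have "gb_X \<alpha> d x w u = gb_X_lvl s \<alpha> d x w u" if "u \<in> gb_parents d v" for u
    using gb_level_sum[OF gb_parents_level[OF assms that]] by (simp add: gb_X_def)
  moreover have "gb_X \<alpha> d x w v = gb_X_lvl (Suc s) \<alpha> d x w v"
    using gb_level_sum[OF assms] by (simp add: gb_X_def)
  ultimately show ?thesis by (simp add: sum.distrib algebra_simps)
qed

text \<open>A finite part of the edge set that contains all noises reaching level \<open>t\<close>.
  Pairs are generated from the upper endpoint so that sums split by level and then by
  parents.\<close>

definition gb_edges_upto :: "nat \<Rightarrow> nat \<Rightarrow> ((nat \<Rightarrow> nat) \<times> (nat \<Rightarrow> nat)) set" where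
  "gb_edges_upto d t = (\<lambda>(v, u). (u, v)) ` (SIGMA v:(\<Union>s<t. gb_level d (Suc s)). gb_parents d v)"

lemma finite_gb_edges_upto: "finite (gb_edges_upto d t)"
  by (auto simp: gb_edges_upto_def finite_gb_level finite_gb_parents)

lemma gb_edges_upto_subset: "gb_edges_upto d t \<subseteq> gb_edges d"
  by (auto simp: gb_edges_upto_def gb_edges_def gb_level_def)

lemma sum_gb_edges_upto:
  "(\<Sum>e\<in>gb_edges_upto d t. f e) =
    (\<Sum>s<t. \<Sum>v\<in>gb_level d (Suc s). \<Sum>u\<in>gb_parents d v. f (u, v))"
proof -
  have "(\<Sum>e\<in>gb_edges_upto d t. f e) = (\<Sum>(v, u)\<in>(SIGMA v:(\<Union>s<t. gb_level d (Suc s)). gb_parents d v). f (u, v))"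
    unfolding gb_edges_upto_def by (subst sum.reindex) (auto simp: inj_on_def intro: sum.cong)
  also have "\<dots> = (\<Sum>v\<in>(\<Union>s<t. gb_level d (Suc s)). \<Sum>u\<in>gb_parents d v. f (u, v))"
    by (rule sum.Sigma[symmetric]) (auto simp: finite_gb_level finite_gb_parents)
  also have "\<dots> = (\<Sum>s<t. \<Sum>v\<in>gb_level d (Suc s). \<Sum>u\<in>gb_parents d v. f (u, v))"
    by (rule sum.UNION_disjoint) (auto simp: finite_gb_level, auto simp: gb_level_def)
  finally show ?thesis .
qed

section \<open>Covariance and variance by duality and Cauchy-Schwarz\<close>

theorem mainTheorem10:
  fixes M :: "'s measure"
    and Z :: "((nat \<Rightarrow> nat) \<times> (nat \<Rightarrow> nat)) option \<Rightarrow> 's \<Rightarrow> real"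
    and d t :: nat and \<alpha> :: "nat \<Rightarrow> real" and a :: "(nat \<Rightarrow> nat) \<Rightarrow> real"
  assumes "prob_space M"
    and "prob_space.indep_vars M (\<lambda>_. borel) Z (insert None (Some ` gb_edges d))"
    and "\<forall>k \<in> insert None (Some ` gb_edges d). distributed M lborel (Z k) std_normal_density"
    and "d \<ge> 1"
    and "\<forall>i \<in> {1..d+1}. 0 < \<alpha> i \<and> \<alpha> i \<le> 1 / real i"
    and "real t > (exp ^^ (5*d+4)) 1"
    and "\<exists>u \<in> gb_level d t. a u \<noteq> 0"
  shows "let C = Max ((\<lambda>i. 1 / (sqrt (real i) * \<alpha> i)) ` {1..d+1});
             X0 = Z None;
             \<zeta> = (\<lambda>\<omega>. \<Sum>u\<in>gb_level d t. a u * gb_X \<alpha> d (Z None \<omega>) (\<lambda>e. Z (Some e) \<omega>) u)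
         in \<bar>prob_space.covariance M \<zeta> X0\<bar> / sqrt (prob_space.variance M \<zeta>)
              \<le> C / (ln ^^ (2*d+2)) (real t)"
proof -
  interpret prob_space M by fact
  let ?np = "\<lambda>v. card (gb_parents d v)"
  define l where "l = (ln ^^ (2*d+2)) (real t)"
  define C where "C = Max ((\<lambda>i. 1 / (sqrt (real i) * \<alpha> i)) ` {1..d+1})"
  define \<zeta> where "\<zeta> = (\<lambda>\<omega>. \<Sum>u\<in>gb_level d t. a u * gb_X \<alpha> d (Z None \<omega>) (\<lambda>e. Z (Some e) \<omega>) u)"
  obtain Q where Q: "0 < Q" "0 < l" "real (d + 1) * l\<^sup>2 \<le> real Q" "cutoff_radius (d + 1) Q (d + 1) \<le> t"
    using cutoff_radius_iterated_log[OF assms(4,6)] unfolding l_def by blast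
  obtain \<phi> where \<phi>: "\<phi> (\<lambda>_. 0) = 1" "\<And>v. v \<in> gb_level d t \<Longrightarrow> \<phi> v = 0"
    "(\<Sum>s<t. \<Sum>v\<in>gb_level d (Suc s). (\<phi> v - \<alpha> (?np v) * (\<Sum>u\<in>gb_parents d v. \<phi> u))\<^sup>2)
      \<le> real (d + 1) / real Q"
    using gb_test_function[OF assms(5) Q(1,4)] by blast
  define g where "g v = \<phi> v - \<alpha> (?np v) * (\<Sum>u\<in>gb_parents d v. \<phi> u)" for v
  obtain A where A: "\<forall>\<psi>. (\<Sum>v\<in>gb_level d t. a v * \<psi> v) = A 0 (\<lambda>_. 0) * \<psi> (\<lambda>_. 0) +
      (\<Sum>s<t. \<Sum>v\<in>gb_level d (Suc s). A (Suc s) v *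
        (\<psi> v - \<alpha> (?np v) * (\<Sum>u\<in>gb_parents d v. \<psi> u)))"
    using gb_adjoint_recursion[where d = d and t = t and a = a and \<alpha> = \<alpha>] by (rule exE)
  define A0 where "A0 = A 0 (\<lambda>_. 0)"

  \<comment> \<open>Coefficients of the noises in \<open>\<zeta>\<close>: the root carries the
    weight of the minimal point, an edge carries the weight of its upper endpoint times
    \<alpha>.\<close>
  define b :: "((nat \<Rightarrow> nat) \<times> (nat \<Rightarrow> nat)) option \<Rightarrow> real"
    where "b k = (case k of None \<Rightarrow> A0 | Some (u, v) \<Rightarrow> A (\<Sum>i\<le>d. v i) v * \<alpha> (?np v))" for k
  define J where "J = insert None (Some ` gb_edges_upto d t)"
  have J: "finite J" "J \<subseteq> insert None (Some ` gb_edges d)"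
    using gb_edges_upto_subset[of d t] by (simp_all only: J_def finite_insert finite_imageI finite_gb_edges_upto) blast
  have sum_J: "(\<Sum>k\<in>J. f k) = f None +
      (\<Sum>s<t. \<Sum>v\<in>gb_level d (Suc s). \<Sum>u\<in>gb_parents d v. f (Some (u, v)))"
    for f :: "((nat \<Rightarrow> nat) \<times> (nat \<Rightarrow> nat)) option \<Rightarrow> real"
    using sum_gb_edges_upto[of "\<lambda>e. f (Some e)"]
    by (simp add: J_def finite_gb_edges_upto sum.reindex image_iff)
  have b_Some: "b (Some (u, v)) = A (Suc s) v * \<alpha> (?np v)" if "v \<in> gb_level d (Suc s)" for u v s
    using gb_level_sum[OF that] by (simp add: b_def)
  have \<zeta>_eq: "\<zeta> = (\<lambda>\<omega>. \<Sum>k\<in>J. b k * Z k \<omega>)"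
  proof
    fix \<omega>
    have "\<zeta> \<omega> = A0 * gb_X \<alpha> d (Z None \<omega>) (\<lambda>e. Z (Some e) \<omega>) (\<lambda>_. 0) +
        (\<Sum>s<t. \<Sum>v\<in>gb_level d (Suc s). A (Suc s) v *
          (\<alpha> (?np v) * (\<Sum>u\<in>gb_parents d v. Z (Some (u, v)) \<omega>)))"
      unfolding \<zeta>_def A[rule_format] A0_def
      by (intro arg_cong2[where f = "(+)"] refl sum.cong) (simp only: gb_X_defect)
    also have "\<dots> = (\<Sum>k\<in>J. b k * Z k \<omega>)"
      unfolding sum_J
      by (intro arg_cong2[where f = "(+)"] sum.cong refl)
        (simp_all add: b_Some gb_X_def sum_distrib_left mult.assoc, simp add: b_def)
    finally show "\<zeta> \<omega> = (\<Sum>k\<in>J. b k * Z k \<omega>)" .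
  qed
  note cov = covariance_standard_normal_combination[OF assms(2) assms(3)[rule_format] J]
  \<comment> \<open>The root value is written over the same index set, so that one covariance
    formula covers both quantities.\<close>
  have X0: "Z None = (\<lambda>\<omega>. \<Sum>k\<in>J. of_bool (k = None) * Z k \<omega>)"
    by (simp add: sum_J)
  have Cov: "covariance \<zeta> (Z None) = A0"
    using cov[of b "\<lambda>k. of_bool (k = None)"] unfolding \<zeta>_eq[symmetric] X0[symmetric]
    by (simp add: sum_J b_def)
  have "variance \<zeta> = covariance \<zeta> \<zeta>"
    by (simp add: covariance_def power2_eq_square)
  also have "\<dots> = (\<Sum>k\<in>J. (b k)\<^sup>2)"
    using cov[of b b] by (simp add: \<zeta>_eq power2_eq_square)
  also have "\<dots> = A0\<^sup>2 + (\<Sum>s<t. \<Sum>v\<in>gb_level d (Suc s). real (?np v) * (\<alpha> (?np v))\<^sup>2 * (A (Suc s) v)\<^sup>2)"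
    unfolding sum_J
    by (intro arg_cong2[where f = "(+)"] sum.cong refl)
      (simp_all add: b_Some power_mult_distrib mult_ac, simp add: b_def)
  finally have Var: "variance \<zeta> =
      A0\<^sup>2 + (\<Sum>s<t. \<Sum>v\<in>gb_level d (Suc s). real (?np v) * (\<alpha> (?np v))\<^sup>2 * (A (Suc s) v)\<^sup>2)" .

  \<comment> \<open>By the choice of \<open>C\<close>, each variance weight i \<alpha>_i^2 is at
    least 1/C^2, so the unweighted square sum of \<open>A\<close> is at most C^2 times the
    variance.\<close>
  have C: "1 \<le> C\<^sup>2 * (real i * (\<alpha> i)\<^sup>2)" "0 < C" if i: "i \<in> {1..d+1}" for i
  proof -
    have pos: "0 < sqrt (real i) * \<alpha> i" using assms(5) i by auto
    have "1 / (sqrt (real i) * \<alpha> i) \<le> C" unfolding C_def using i by (intro Max_ge) auto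
    with pos have "1 \<le> C * (sqrt (real i) * \<alpha> i)" by (simp add: pos_divide_le_eq)
    then have "1\<^sup>2 \<le> (C * (sqrt (real i) * \<alpha> i))\<^sup>2" by (intro power_mono) auto
    then show "1 \<le> C\<^sup>2 * (real i * (\<alpha> i)\<^sup>2)" by (simp add: power_mult_distrib)
    show "0 < C" using \<open>1 / (sqrt (real i) * \<alpha> i) \<le> C\<close> pos by (smt (verit) divide_pos_pos)
  qed
  have C_pos: "0 < C" using C(2)[of 1] by simp
  have "(\<Sum>s<t. \<Sum>v\<in>gb_level d (Suc s). (A (Suc s) v)\<^sup>2)
      \<le> (\<Sum>s<t. \<Sum>v\<in>gb_level d (Suc s). C\<^sup>2 * (real (?np v) * (\<alpha> (?np v))\<^sup>2 * (A (Suc s) v)\<^sup>2))"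
  proof (intro sum_mono)
    fix s v assume "v \<in> gb_level d (Suc s)"
    then have "?np v \<in> {1..d+1}" using card_gb_parents_pos card_gb_parents_le by fastforce
    from mult_right_mono[OF C(1)[OF this], of "(A (Suc s) v)\<^sup>2"]
    show "(A (Suc s) v)\<^sup>2 \<le> C\<^sup>2 * (real (?np v) * (\<alpha> (?np v))\<^sup>2 * (A (Suc s) v)\<^sup>2)"
      by (simp add: mult.assoc)
  qed
  also have "\<dots> = C\<^sup>2 * (variance \<zeta> - A0\<^sup>2)" unfolding Var by (simp add: sum_distrib_left)
  also have "\<dots> \<le> C\<^sup>2 * variance \<zeta>" by (intro mult_left_mono) auto
  finally have A_le: "(\<Sum>s<t. \<Sum>v\<in>gb_level d (Suc s). (A (Suc s) v)\<^sup>2) \<le> C\<^sup>2 * variance \<zeta>" .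

  \<comment> \<open>For \<phi> the left side of the adjoint identity vanishes on level
    \<open>t\<close>, and \<phi> is 1 at the root.\<close>
  have "A0 = - (\<Sum>s<t. \<Sum>v\<in>gb_level d (Suc s). A (Suc s) v * g v)"
    using A[rule_format, of \<phi>] \<phi>(1,2) by (simp add: A0_def g_def)
  then have "A0\<^sup>2 = (\<Sum>s<t. \<Sum>v\<in>gb_level d (Suc s). A (Suc s) v * g v)\<^sup>2" by simp
  \<comment> \<open>Level and point are merged into one index so that Cauchy-Schwarz applies once to
    all levels.\<close>
  also have "\<dots> = (\<Sum>(s, v)\<in>(SIGMA s:{..<t}. gb_level d (Suc s)). A (Suc s) v * g v)\<^sup>2"
    by (subst sum.Sigma) (auto simp: finite_gb_level)
  also have "\<dots> \<le> (\<Sum>(s, v)\<in>(SIGMA s:{..<t}. gb_level d (Suc s)). (A (Suc s) v)\<^sup>2) *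
      (\<Sum>(s, v)\<in>(SIGMA s:{..<t}. gb_level d (Suc s)). (g v)\<^sup>2)"
    unfolding case_prod_unfold by (rule Cauchy_Schwarz_ineq_sum)
  also have "\<dots> = (\<Sum>s<t. \<Sum>v\<in>gb_level d (Suc s). (A (Suc s) v)\<^sup>2) *
      (\<Sum>s<t. \<Sum>v\<in>gb_level d (Suc s). (g v)\<^sup>2)"
    by (subst (1 2) sum.Sigma) (auto simp: finite_gb_level)
  also have "\<dots> \<le> C\<^sup>2 * variance \<zeta> * (real (d + 1) / real Q)"
    using A_le \<phi>(3) by (intro mult_mono) (auto simp: g_def intro!: sum_nonneg)
  also have "\<dots> \<le> C\<^sup>2 * variance \<zeta> * (1 / l\<^sup>2)"
    using Q by (intro mult_left_mono) (auto simp: field_simps)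
  finally have main: "A0\<^sup>2 \<le> variance \<zeta> * (C / l)\<^sup>2" by (simp add: power_divide mult_ac)

  have "\<bar>A0\<bar> / sqrt (variance \<zeta>) \<le> C / l"
  \<comment> \<open>Division by zero is 0 in HOL, so zero variance leaves only the nonnegativity of
    C/l.\<close>
  proof (cases "variance \<zeta> = 0")
    case True
    then show ?thesis using C_pos Q by simp
  next
    case False
    then have V: "0 < variance \<zeta>" using variance_positive[of \<zeta>] by linarith
    have "\<bar>A0\<bar> \<le> sqrt (variance \<zeta> * (C / l)\<^sup>2)" using main by (intro real_le_rsqrt) simp
    also have "\<dots> = sqrt (variance \<zeta>) * (C / l)" using C_pos Q by (simp add: real_sqrt_mult)
    finally show ?thesis using V by (simp add: pos_divide_le_eq mult.commute)
  qed
  then show ?thesis unfolding Let_def C_def[symmetric] \<zeta>_def[symmetric] l_def[symmetric] Cov .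
qed

end
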